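(* Let $(X,GP)$ be a GP-metric space and let $(X,p_{GP})$ be its associated partial metric space, where $p_{GP}(x,y)=GP(x,y,y)$ for all $x,y\in X$. (1) A sequence $\{x_n\}_{n\ge1}$ in $X$ is a GP-Cauchy sequence in $(X,GP)$ if and only if it is a Cauchy sequence in $(X,p_{GP})$. (2) $(X,GP)$ is GP-complete if and only if $(X,p_{GP})$ is complete.
   Context: Let $X$ be a non-empty set. A GP-metric on $X$ is a function $GP:X\times X\times X\to[0,\infty)$ such that for all $x,y,z,a\in X$: (GP1) $0\le GP(x,x,x)\le GP(x,x,y)\le GP(x,y,z)$; (GP2) $GP$ is invariant under all permutations of its three arguments; (GP3) $GP(x,y,z)\le GP(x,a,a)+GP(a,y,z)-GP(a,a,a)$; (GP4) $x=y=z$ if $GP(x,y,z)=GP(x,x,x)=GP(y,y,y)=GP(z,z,z)$. The pair $(X,GP)$ is a GP-metric space. A sequence $\{x_n\}_{n\ge1}$ in $X$ is GP-convergent to $x\in X$ if $GP(x,x,x)=\lim_{n\to\infty}GP(x_n,x_n,x_n)=\lim_{n\to\infty}GP(x,x,x_n)$. It is GP-Cauchy if $\lim_{n,m\to\infty}GP(x_n,x_m,x_m)$ exists and is finite. $(X,GP)$ is GP-complete if every GP-Cauchy sequence $\{y_n\}_{n\ge1}$ converges to a point $x\in X$ such that $GP(x,x,x)=\lim_{n,m\to\infty}GP(y_n,y_m,y_m)$. A partial metric on $X$ is a function $p:X\times X\to[0,\infty)$ such that for all $x,y,z\in X$: (P1) $x=y$ if and only if $p(x,x)=p(x,y)=p(y,y)$;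 (P2) $p(x,x)\le p(x,y)$; (P3) $p(x,y)=p(y,x)$; (P4) $p(x,z)\le p(x,y)+p(y,z)-p(y,y)$. The function $p_{GP}$ is a partial metric on $X$. In a partial metric space $(X,p)$, a sequence $\{x_n\}_{n\ge1}$ converges to $x\in X$ if $\lim_{n\to\infty}p(x_n,x)=p(x,x)$; it is Cauchy if $\lim_{n,m\to\infty}p(x_n,x_m)$ exists and is finite. $(X,p)$ is complete if every Cauchy sequence $\{x_n\}_{n\ge1}$ converges to some $x\in X$ such that $\lim_{n,m\to\infty}p(x_n,x_m)=p(x,x)$. *)

theory Defs
  imports Complex_Main
begin

locale GP_metric_space =
  fixes X :: "'a set" and GP :: "'a \<Rightarrow> 'a \<Rightarrow> 'a \<Rightarrow> real"
  assumes nonempty: "X \<noteq> {}"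
    and nonneg: "\<lbrakk>x \<in> X; y \<in> X; z \<in> X\<rbrakk> \<Longrightarrow> 0 \<le> GP x y z"
    and GP1: "\<lbrakk>x \<in> X; y \<in> X; z \<in> X\<rbrakk> \<Longrightarrow>
      0 \<le> GP x x x \<and> GP x x x \<le> GP x x y \<and> GP x x y \<le> GP x y z"
    and GP2: "\<lbrakk>x \<in> X; y \<in> X; z \<in> X\<rbrakk> \<Longrightarrow>
      GP x y z = GP x z y \<and> GP x y z = GP y x z \<and> GP x y z = GP y z x \<and>
      GP x y z = GP z x y \<and> GP x y z = GP z y x"
    and GP3: "\<lbrakk>x \<in> X; y \<in> X; z \<in> X; a \<in> X\<rbrakk> \<Longrightarrow>
      GP x y z \<le> GP x a a + GP a y z - GP a a a"
    and GP4: "\<lbrakk>x \<in> X; y \<in> X; z \<in> X; GP x y z = GP x x x; GP x x x = GP y y y;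
      GP y y y = GP z z z\<rbrakk> \<Longrightarrow> x = y \<and> y = z"

locale partial_metric_space =
  fixes X :: "'a set" and p :: "'a \<Rightarrow> 'a \<Rightarrow> real"
  assumes nonempty: "X \<noteq> {}"
    and nonneg: "\<lbrakk>x \<in> X; y \<in> X\<rbrakk> \<Longrightarrow> 0 \<le> p x y"
    and P1: "\<lbrakk>x \<in> X; y \<in> X\<rbrakk> \<Longrightarrow> x = y \<longleftrightarrow> p x x = p x y \<and> p x y = p y y"
    and P2: "\<lbrakk>x \<in> X; y \<in> X\<rbrakk> \<Longrightarrow> p x x \<le> p x y"
    and P3: "\<lbrakk>x \<in> X; y \<in> X\<rbrakk> \<Longrightarrow> p x y = p y x"
    and P4: "\<lbrakk>x \<in> X; y \<in> X; z \<in> X\<rbrakk> \<Longrightarrow> p x z \<le> p x y + p y z - p y y"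

text \<open>Sequences are indexed by the positive integers; the value at 0 is irrelevant, and
  none of the limits below depends on it.\<close>

definition seq_in :: "'a set \<Rightarrow> (nat \<Rightarrow> 'a) \<Rightarrow> bool" where
  "seq_in X x \<longleftrightarrow> (\<forall>n\<ge>1. x n \<in> X)"

text \<open>Double limits as n and m tend to infinity independently are limits along the product
  filter; a real limit value is automatically finite.\<close>

definition GP_converges :: "('a \<Rightarrow> 'a \<Rightarrow> 'a \<Rightarrow> real) \<Rightarrow> (nat \<Rightarrow> 'a) \<Rightarrow> 'a \<Rightarrow> bool" where
  "GP_converges GP x l \<longleftrightarrow>
     (\<lambda>n. GP (x n) (x n) (x n)) \<longlonglongrightarrow> GP l l l \<and> (\<lambda>n. GP l l (x n)) \<longlonglongrightarrow> GP l l l"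

definition GP_Cauchy :: "('a \<Rightarrow> 'a \<Rightarrow> 'a \<Rightarrow> real) \<Rightarrow> (nat \<Rightarrow> 'a) \<Rightarrow> bool" where
  "GP_Cauchy GP x \<longleftrightarrow>
     (\<exists>L. ((\<lambda>(n, m). GP (x n) (x m) (x m)) \<longlongrightarrow> L) (sequentially \<times>\<^sub>F sequentially))"

definition GP_complete :: "'a set \<Rightarrow> ('a \<Rightarrow> 'a \<Rightarrow> 'a \<Rightarrow> real) \<Rightarrow> bool" where
  "GP_complete X GP \<longleftrightarrow>
     (\<forall>y. seq_in X y \<and> GP_Cauchy GP y \<longrightarrow>
       (\<exists>l\<in>X. GP_converges GP y l \<and>
         ((\<lambda>(n, m). GP (y n) (y m) (y m)) \<longlongrightarrow> GP l l l) (sequentially \<times>\<^sub>F sequentially)))"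

definition pm_converges :: "('a \<Rightarrow> 'a \<Rightarrow> real) \<Rightarrow> (nat \<Rightarrow> 'a) \<Rightarrow> 'a \<Rightarrow> bool" where
  "pm_converges p x l \<longleftrightarrow> (\<lambda>n. p (x n) l) \<longlonglongrightarrow> p l l"

definition pm_Cauchy :: "('a \<Rightarrow> 'a \<Rightarrow> real) \<Rightarrow> (nat \<Rightarrow> 'a) \<Rightarrow> bool" where
  "pm_Cauchy p x \<longleftrightarrow>
     (\<exists>L. ((\<lambda>(n, m). p (x n) (x m)) \<longlongrightarrow> L) (sequentially \<times>\<^sub>F sequentially))"

definition pm_complete :: "'a set \<Rightarrow> ('a \<Rightarrow> 'a \<Rightarrow> real) \<Rightarrow> bool" where
  "pm_complete X p \<longleftrightarrow>
     (\<forall>x. seq_in X x \<and> pm_Cauchy p x \<longrightarrow>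
       (\<exists>l\<in>X. pm_converges p x l \<and>
         ((\<lambda>(n, m). p (x n) (x m)) \<longlongrightarrow> p l l) (sequentially \<times>\<^sub>F sequentially)))"

definition p_GP :: "('a \<Rightarrow> 'a \<Rightarrow> 'a \<Rightarrow> real) \<Rightarrow> 'a \<Rightarrow> 'a \<Rightarrow> real" where
  "p_GP GP x y = GP x y y"

lemma (in GP_metric_space) GP_swap:
  assumes "x \<in> X" "y \<in> X"
  shows "GP x y y = GP x x y"
proof (rule antisym)
  show "GP x x y \<le> GP x y y" using GP1[of x y y] assms by blast
  have "GP y y x \<le> GP y x x" using GP1[of y x x] assms by blast
  then show "GP x y y \<le> GP x x y" using GP2[of x y y] GP2[of x x y] assms by simp
qed

lemma (in GP_metric_space) partial_metric_space_p_GP: "partial_metric_space X (p_GP GP)"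
proof
  fix x y assume xy: "x \<in> X" "y \<in> X"
  show "0 \<le> p_GP GP x y" using nonneg xy by (simp add: p_GP_def)
  show "x = y \<longleftrightarrow> p_GP GP x x = p_GP GP x y \<and> p_GP GP x y = p_GP GP y y"
    using GP4[of x y y] xy by (auto simp: p_GP_def)
  show "p_GP GP x x \<le> p_GP GP x y" using GP1[of x y y] GP_swap[of x y] xy by (simp add: p_GP_def)
  show "p_GP GP x y = p_GP GP y x" using GP2[of x x y] GP_swap[of x y] xy by (simp add: p_GP_def)
next
  fix x y z assume "x \<in> X" "y \<in> X" "z \<in> X"
  then show "p_GP GP x z \<le> p_GP GP x y + p_GP GP y z - p_GP GP y y"
    using GP3[of x z z y] by (simp add: p_GP_def)
qed (rule nonempty)

end

theory Submission
  imports Defs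
begin

text \<open>The double sequences GP(x_n,x_m,x_m) and p_GP(x_n,x_m) are the same by definition, so
  both Cauchy notions coincide. For completeness the same limit point l serves both sides: once the
  double limit is GP(l,l,l), the two notions of convergence to l agree
  (\<open>GP_converges_iff_pm_converges\<close>).\<close>

lemma GP_Cauchy_iff_pm_Cauchy: "GP_Cauchy GP x \<longleftrightarrow> pm_Cauchy (p_GP GP) x"
  by (simp add: GP_Cauchy_def pm_Cauchy_def p_GP_def)

text \<open>The map n -> (n, n) tends to the product filter along \<open>F\<close>; compose the
  double limit with it.\<close>

lemma tendsto_diagonal:
  assumes "((\<lambda>(n, m). f n m) \<longlongrightarrow> L) (F \<times>\<^sub>F F)"
  shows "((\<lambda>n. f n n) \<longlongrightarrow> L) F"
  using filterlim_compose[OF assms filterlim_Pair[OF filterlim_ident filterlim_ident]] by simp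

text \<open>GP-convergence also asks for convergence of the self-distances, which convergence in the
  partial metric does not give; the double limit provides it along the diagonal.\<close>

lemma (in GP_metric_space) GP_converges_iff_pm_converges:
  assumes "seq_in X x" "l \<in> X"
    and lim: "((\<lambda>(n, m). GP (x n) (x m) (x m)) \<longlongrightarrow> GP l l l) (sequentially \<times>\<^sub>F sequentially)"
  shows "GP_converges GP x l \<longleftrightarrow> pm_converges (p_GP GP) x l"
proof -
  \<comment> \<open>This is the permutation symmetry (GP2). It is claimed only eventually because
    \<open>seq_in\<close> leaves \<open>x 0\<close> unconstrained.\<close>
  have "\<forall>\<^sub>F n in sequentially. GP l l (x n) = p_GP GP (x n) l"
    using eventually_ge_at_top[of 1]
  proof eventually_elim
    case (elim n)
    then have "x n \<in> X" using assms(1) by (simp add: seq_in_def)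
    then show ?case using GP2[of l l "x n"] assms(2) by (simp add: p_GP_def)
  qed
  then have "(\<lambda>n. GP l l (x n)) \<longlonglongrightarrow> GP l l l \<longleftrightarrow> (\<lambda>n. p_GP GP (x n) l) \<longlonglongrightarrow> GP l l l"
    by (rule tendsto_cong)
  then show ?thesis
    using tendsto_diagonal[OF lim] by (simp add: GP_converges_def pm_converges_def p_GP_def)
qed

lemma (in GP_metric_space) GP_complete_iff_pm_complete:
  "GP_complete X GP \<longleftrightarrow> pm_complete X (p_GP GP)"
proof -
  \<comment> \<open>The second conjunct is the same double limit on both sides and supplies the
    hypothesis under which the two convergences agree.\<close>
  have "(\<exists>l\<in>X. GP_converges GP x l \<and>
      ((\<lambda>(n, m). GP (x n) (x m) (x m)) \<longlongrightarrow> GP l l l) (sequentially \<times>\<^sub>F sequentially)) \<longleftrightarrow>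
    (\<exists>l\<in>X. pm_converges (p_GP GP) x l \<and>
      ((\<lambda>(n, m). p_GP GP (x n) (x m)) \<longlongrightarrow> p_GP GP l l) (sequentially \<times>\<^sub>F sequentially))"
    if "seq_in X x" for x
    using GP_converges_iff_pm_converges[OF that] by (auto simp: p_GP_def)
  then show ?thesis
    unfolding GP_complete_def pm_complete_def GP_Cauchy_iff_pm_Cauchy by blast
qed

theorem corollary3p7:
  fixes X :: "'a set" and GP :: "'a \<Rightarrow> 'a \<Rightarrow> 'a \<Rightarrow> real"
  assumes "GP_metric_space X GP"
  shows "(\<forall>x :: nat \<Rightarrow> 'a. seq_in X x \<longrightarrow> (GP_Cauchy GP x \<longleftrightarrow> pm_Cauchy (p_GP GP) x)) \<and>
         (GP_complete X GP \<longleftrightarrow> pm_complete X (p_GP GP))"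
  using GP_Cauchy_iff_pm_Cauchy GP_metric_space.GP_complete_iff_pm_complete[OF assms] by blast

end
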